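(* There exist absolute constants $c,C>0$ such that the following holds. Let $n\ge1$ be an integer and let $\xi_1,\dots,\xi_n$ be i.i.d. copies of a $\log$-$\gamma_{1,2}$ distributed random variable $\xi$. Then, for all $x\in\mathbb{R}^n$, $$c\,\|x\|_2\le\mathbb{E}\max_{1\le i\le n}|x_i\xi_i|\le C\,\|x\|_2,$$ where $\|x\|_2=\big(\sum_{i=1}^n x_i^2\big)^{1/2}$.
   Context: For parameters $q,p>0$, a random variable is $\log$-$\gamma_{q,p}$ distributed if it has density $f(x)=\frac{p^q}{\Gamma(q)}x^{-p-1}(\ln x)^{q-1}$ for $x\ge1$ and $f(x)=0$ for $x<1$; in particular the $\log$-$\gamma_{1,2}$ density is $2x^{-3}$ on $[1,\infty)$. *)

theory Defs
  imports "HOL-Probability.Probability"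
begin

text \<open>
  The case distinction on \<open>q = 1\<close> enforces the convention \<open>0\<^sup>0 = 1\<close>, as \<open>0 powr 0 = 0\<close> in HOL; it only
  affects the value at \<open>x = 1\<close>.
\<close>

definition log_gamma_density :: "real \<Rightarrow> real \<Rightarrow> real \<Rightarrow> real" where
  "log_gamma_density q p x =
    (if 1 \<le> x
     then p powr q / Gamma q * x powr (- p - 1) * (if q = 1 then 1 else ln x powr (q - 1))
     else 0)"

lemma log_gamma_density_1_2:
  "log_gamma_density 1 2 x = (if 1 \<le> x then 2 / x ^ 3 else 0)"
proof (cases "1 \<le> x")
  case True
  have "x powr (- 3) = 1 / x ^ 3"
    using True powr_realpow[of x 3] by (simp add: powr_minus_divide)
  then show ?thesis
    using True by (simp add: log_gamma_density_def)
qed (simp add: log_gamma_density_def)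

definition log_gamma_distributed :: "'a measure \<Rightarrow> real \<Rightarrow> real \<Rightarrow> ('a \<Rightarrow> real) \<Rightarrow> bool" where
  "log_gamma_distributed M q p X \<longleftrightarrow>
    distributed M lborel X (\<lambda>x. ennreal (log_gamma_density q p x))"

definition iid_log_gamma ::
  "'a measure \<Rightarrow> real \<Rightarrow> real \<Rightarrow> nat \<Rightarrow> (nat \<Rightarrow> 'a \<Rightarrow> real) \<Rightarrow> bool" where
  "iid_log_gamma M q p n \<xi> \<longleftrightarrow>
    prob_space M \<and>
    prob_space.indep_vars M (\<lambda>_. borel) \<xi> {1..n} \<and>
    (\<forall>i\<in>{1..n}. log_gamma_distributed M q p (\<xi> i))"

text \<open>
  The two-sided estimate with given constants, for all probability spaces on a given type of
  sample points. Vectors in \<open>\<real>\<^sup>n\<close> are functions on \<open>nat\<close> of which only the values on \<open>{1..n}\<close> are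
  used. Integrability is stated separately because the Bochner integral of a non-integrable
  function is \<open>0\<close>.

  HOL cannot quantify over the type of sample points below an existential quantifier, so a
  statement \<open>\<exists>c C. expected_max_bounds TYPE('a) c C\<close> would let the constants depend on \<open>'a\<close>.
  Absolute constants are therefore chosen for the fixed type \<open>nat \<Rightarrow> real\<close>, which carries the
  joint law of any finite family of real random variables, and the same constants are required
  to work for every other type.
\<close>

definition expected_max_bounds :: "'a itself \<Rightarrow> real \<Rightarrow> real \<Rightarrow> bool" where
  "expected_max_bounds _ c C \<longleftrightarrow>
    (\<forall>n\<ge>1. \<forall>(M :: 'a measure) \<xi>. iid_log_gamma M 1 2 n \<xi> \<longrightarrow>
      (\<forall>x :: nat \<Rightarrow> real.
        integrable M (\<lambda>\<omega>. MAX i\<in>{1..n}. \<bar>x i * \<xi> i \<omega>\<bar>) \<and>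
        c * sqrt (\<Sum>i=1..n. (x i)\<^sup>2) \<le> (LINT \<omega>|M. (MAX i\<in>{1..n}. \<bar>x i * \<xi> i \<omega>\<bar>)) \<and>
        (LINT \<omega>|M. (MAX i\<in>{1..n}. \<bar>x i * \<xi> i \<omega>\<bar>)) \<le> C * sqrt (\<Sum>i=1..n. (x i)\<^sup>2)))"

end

theory Submission
  imports Defs
begin

text \<open>
  Write \<open>N = \<parallel>x\<parallel>\<^sub>2\<close>, suppose \<open>N > 0\<close>, and let \<open>Y\<close> be the maximum. The density \<open>2 / t ^ 3\<close> has tail
  \<open>P (\<xi> \<ge> s) = 1 / s\<^sup>2\<close> for \<open>s \<ge> 1\<close>, so each \<open>\<bar>x\<^sub>i \<xi>\<^sub>i\<bar>\<close> exceeds the level \<open>N\<close>, which is at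
  least \<open>\<bar>x\<^sub>i\<bar>\<close>, with probability exactly \<open>x\<^sub>i\<^sup>2 / N\<^sup>2\<close>, and these probabilities add up to \<open>1\<close>.
  Everything happens at this one level.

  From above, \<open>Y\<close> is at most \<open>N\<close> plus the sum of those \<open>\<bar>x\<^sub>i \<xi>\<^sub>i\<bar>\<close> that reach \<open>N\<close>. Each summand has
  expectation \<open>2 x\<^sub>i\<^sup>2 / N\<close> (lemma \<open>log_gamma_truncated_mean\<close>), hence \<open>E Y \<le> N + 2 N\<close>.

  From below, independence shows that \<open>Y\<close> stays under \<open>N\<close> with probability
  \<open>(\<Prod>i. 1 - x\<^sub>i\<^sup>2 / N\<^sup>2) \<le> exp (- (\<Sum>i. x\<^sub>i\<^sup>2 / N\<^sup>2)) = exp (- 1)\<close>, and Markov's inequality at level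
  \<open>N\<close> gives \<open>E Y \<ge> (1 - exp (- 1)) N\<close>.

  These estimates hold on every sample space. That arbitrary constants valid on the sample type
  \<open>nat \<Rightarrow> real\<close> are valid on every other type holds for a different reason: the claim
  concerns the joint law of \<open>\<xi>\<^sub>1, \<dots>, \<xi>\<^sub>n\<close> only, and this law lives on \<open>nat \<Rightarrow> real\<close>, where the
  coordinates form an i.i.d. family with the same law.
\<close>

section \<open>Tails of the distribution\<close>

lemma nn_integral_power_tail:
  fixes s :: real
  assumes "s > 0" "k > 0"
  shows "(\<integral>\<^sup>+t. ennreal (2 / t ^ Suc k) * indicator {s..} t \<partial>lborel) = ennreal (2 / (k * s ^ k))"
proof -
  have "(\<integral>\<^sup>+t. ennreal (2 / t ^ Suc k) * indicator {s..} t \<partial>lborel) = 0 - (- (2 / (k * s ^ k)))"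
  proof (rule nn_integral_FTC_atLeast)
    show "((\<lambda>t::real. - (2 / (k * t ^ k))) has_real_derivative 2 / t ^ Suc k) (at t)"
      if "s \<le> t" for t
    proof -
      have t: "t > 0" using that \<open>s > 0\<close> by simp
      obtain m where m: "k = Suc m" using \<open>k > 0\<close> by (cases k) auto
      have "((\<lambda>t::real. t ^ k) has_real_derivative k * t ^ m) (at t)"
        using DERIV_pow[of k t] by (simp add: m)
      then have "((\<lambda>t. - (2 / k) * inverse (t ^ k)) has_real_derivative
          - (2 / k) * - (k * t ^ m * inverse ((t ^ k) ^ Suc (Suc 0)))) (at t)"
        using t by (intro DERIV_cmult DERIV_inverse_fun) auto
      moreover have "- (2 / k) * - (k * t ^ m * inverse ((t ^ k) ^ Suc (Suc 0))) = 2 / t ^ Suc k"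
        using t by (simp add: m field_simps del: of_nat_Suc)
      ultimately show ?thesis
        by (simp add: field_simps)
    qed
    have "LIM t at_top. real k * (t::real) ^ k :> at_top"
      using \<open>k > 0\<close>
      by (intro filterlim_tendsto_pos_mult_at_top[OF tendsto_const] filterlim_pow_at_top filterlim_ident)
        auto
    then have "((\<lambda>t::real. 2 / (k * t ^ k)) \<longlongrightarrow> 0) at_top"
      by (intro real_tendsto_divide_at_top[OF tendsto_const])
    then show "((\<lambda>t::real. - (2 / (k * t ^ k))) \<longlongrightarrow> 0) at_top"
      using tendsto_minus by fastforce
  qed (use \<open>s > 0\<close> in auto)
  then show ?thesis by simp
qed

text \<open>
  Below the level \<open>N / \<bar>a\<bar> \<ge> 1\<close> nothing is counted, so the cut-off of the density at \<open>1\<close> is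
  invisible and a power integral remains. With \<open>m = 0\<close> this is the tail probability of
  \<open>\<bar>a X\<bar>\<close>, with \<open>m = 1\<close> its truncated mean.
\<close>

lemma log_gamma_truncated_moment:
  assumes X: "log_gamma_distributed M 1 2 X"
    and "a \<noteq> 0" "\<bar>a\<bar> \<le> N" "m < 2"
  shows "(\<integral>\<^sup>+\<omega>. ennreal (\<bar>a * X \<omega>\<bar> ^ m) * indicator {N..} \<bar>a * X \<omega>\<bar> \<partial>M) =
    ennreal (\<bar>a\<bar> ^ m * (2 / (real (2 - m) * (N / \<bar>a\<bar>) ^ (2 - m))))"
proof -
  define s where "s = N / \<bar>a\<bar>"
  have s: "s \<ge> 1" using assms by (simp add: s_def)
  have D: "distributed M lborel X (\<lambda>t. ennreal (log_gamma_density 1 2 t))"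
    using X by (simp add: log_gamma_distributed_def)
  have "(\<integral>\<^sup>+\<omega>. ennreal (\<bar>a * X \<omega>\<bar> ^ m) * indicator {N..} \<bar>a * X \<omega>\<bar> \<partial>M) =
    (\<integral>\<^sup>+t. ennreal (log_gamma_density 1 2 t) *
      (ennreal (\<bar>a * t\<bar> ^ m) * indicator {N..} \<bar>a * t\<bar>) \<partial>lborel)"
    by (rule distributed_nn_integral[OF D, symmetric]) simp
  also have "\<dots> =
    (\<integral>\<^sup>+t. ennreal (\<bar>a\<bar> ^ m) * (ennreal (2 / t ^ Suc (2 - m)) * indicator {s..} t) \<partial>lborel)"
  proof (rule nn_integral_cong)
    fix t :: real
    have level: "N \<le> \<bar>a * t\<bar> \<longleftrightarrow> s \<le> \<bar>t\<bar>"
      using \<open>a \<noteq> 0\<close> by (simp add: s_def abs_mult field_simps)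
    show "ennreal (log_gamma_density 1 2 t) * (ennreal (\<bar>a * t\<bar> ^ m) * indicator {N..} \<bar>a * t\<bar>) =
      ennreal (\<bar>a\<bar> ^ m) * (ennreal (2 / t ^ Suc (2 - m)) * indicator {s..} t)"
    proof (cases "s \<le> t")
      case True
      then have t: "t \<ge> 1" using s by simp
      have "2 / t ^ 3 * (\<bar>a * t\<bar> ^ m) = \<bar>a\<bar> ^ m * (2 / t ^ Suc (2 - m))"
      proof -
        have "t ^ 3 = t ^ Suc (2 - m) * t ^ m"
          using \<open>m < 2\<close> by (simp flip: power_add power_Suc)
        then show ?thesis using t by (simp add: abs_mult power_mult_distrib)
      qed
      then show ?thesis
        using t True level by (simp add: log_gamma_density_1_2 flip: ennreal_mult)
    next
      case False
      then have "\<not> 1 \<le> t \<or> \<not> s \<le> \<bar>t\<bar>" using s by linarith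
      then show ?thesis
        using False level by (auto simp: log_gamma_density_1_2)
    qed
  qed
  also have "\<dots> = ennreal (\<bar>a\<bar> ^ m) *
      (\<integral>\<^sup>+t. ennreal (2 / t ^ Suc (2 - m)) * indicator {s..} t \<partial>lborel)"
    by (rule nn_integral_cmult) simp
  also have "\<dots> = ennreal (\<bar>a\<bar> ^ m * (2 / (real (2 - m) * s ^ (2 - m))))"
    using s \<open>m < 2\<close> by (subst nn_integral_power_tail) (auto simp flip: ennreal_mult)
  finally show ?thesis by (simp add: s_def)
qed

lemma log_gamma_truncated_mean:
  assumes "log_gamma_distributed M 1 2 X" "\<bar>a\<bar> \<le> N" "N > 0"
  shows "(\<integral>\<^sup>+\<omega>. ennreal \<bar>a * X \<omega>\<bar> * indicator {N..} \<bar>a * X \<omega>\<bar> \<partial>M) = ennreal (2 * a\<^sup>2 / N)"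
proof (cases "a = 0")
  case False
  have "\<bar>a\<bar> * (2 / (N / \<bar>a\<bar>)) = 2 * a\<^sup>2 / N"
    by (simp add: power2_eq_square)
  then show ?thesis
    using log_gamma_truncated_moment[OF assms(1) False assms(2), of 1]
    by (simp del: times_divide_eq_right)
qed simp

lemma log_gamma_tail:
  assumes X: "log_gamma_distributed M 1 2 X" and "\<bar>a\<bar> \<le> N" "N > 0"
  shows "measure M {\<omega> \<in> space M. N \<le> \<bar>a * X \<omega>\<bar>} = (a / N)\<^sup>2"
proof (cases "a = 0")
  case False
  have [measurable]: "X \<in> borel_measurable M"
    using X by (simp add: log_gamma_distributed_def distributed_def)
  have "emeasure M {\<omega> \<in> space M. N \<le> \<bar>a * X \<omega>\<bar>} =
      (\<integral>\<^sup>+\<omega>. indicator {\<omega> \<in> space M. N \<le> \<bar>a * X \<omega>\<bar>} \<omega> \<partial>M)"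
    by simp
  also have "\<dots> = (\<integral>\<^sup>+\<omega>. ennreal (\<bar>a * X \<omega>\<bar> ^ 0) * indicator {N..} \<bar>a * X \<omega>\<bar> \<partial>M)"
    by (rule nn_integral_cong) (auto simp: indicator_def)
  also have "\<dots> = ennreal ((a / N)\<^sup>2)"
    using log_gamma_truncated_moment[OF X False assms(2), of 0] by (simp add: power_divide)
  finally show ?thesis by (simp add: measure_def)
qed (use \<open>N > 0\<close> in simp)

section \<open>The two-sided estimate\<close>

lemma abs_le_euclidean_norm:
  fixes x :: "'i \<Rightarrow> real"
  assumes "finite I" "i \<in> I"
  shows "\<bar>x i\<bar> \<le> sqrt (\<Sum>i\<in>I. (x i)\<^sup>2)"
  by (rule real_le_rsqrt) (use assms in \<open>auto intro: member_le_sum\<close>)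

lemma Max_le_level_plus_excess:
  fixes y :: "'i \<Rightarrow> real"
  assumes "finite I" "I \<noteq> {}" "N \<ge> 0" "\<And>i. i \<in> I \<Longrightarrow> 0 \<le> y i"
  shows "(MAX i\<in>I. y i) \<le> N + (\<Sum>i\<in>I. y i * indicator {N..} (y i))"
proof -
  have "y i \<le> N + (\<Sum>i\<in>I. y i * indicator {N..} (y i))" if "i \<in> I" for i
  proof -
    have "y i \<le> N + y i * indicator {N..} (y i)"
      using \<open>N \<ge> 0\<close> by (auto simp: indicator_def)
    also have "\<dots> \<le> N + (\<Sum>i\<in>I. y i * indicator {N..} (y i))"
      using that assms by (intro add_left_mono member_le_sum) auto
    finally show ?thesis .
  qed
  then show ?thesis using assms by simp
qed

text \<open>
  The bound is proved for the integral of nonnegative functions, since in this form it also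
  shows that the maximum is integrable.
\<close>

lemma nn_integral_max_le:
  fixes x :: "nat \<Rightarrow> real"
  assumes iid: "iid_log_gamma M 1 2 n \<xi>" and "n \<ge> 1"
    and N_def: "N = sqrt (\<Sum>i=1..n. (x i)\<^sup>2)" and "N > 0"
  shows "(\<integral>\<^sup>+\<omega>. ennreal (MAX i\<in>{1..n}. \<bar>x i * \<xi> i \<omega>\<bar>) \<partial>M) \<le> ennreal (3 * N)"
proof -
  interpret prob_space M using iid by (simp add: iid_log_gamma_def)
  have X: "log_gamma_distributed M 1 2 (\<xi> i)" if "i \<in> {1..n}" for i
    using iid that by (simp add: iid_log_gamma_def)
  have [measurable]: "\<xi> i \<in> borel_measurable M" if "i \<in> {1..n}" for i
    using X[OF that] by (simp add: log_gamma_distributed_def distributed_def)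
  have le: "\<bar>x i\<bar> \<le> N" if "i \<in> {1..n}" for i
    unfolding N_def using that by (intro abs_le_euclidean_norm) auto
  have sum_sq: "(\<Sum>i=1..n. (x i)\<^sup>2) = N\<^sup>2"
    by (simp add: N_def sum_nonneg)
  have "(\<integral>\<^sup>+\<omega>. ennreal (MAX i\<in>{1..n}. \<bar>x i * \<xi> i \<omega>\<bar>) \<partial>M) \<le>
    (\<integral>\<^sup>+\<omega>. ennreal N +
      (\<Sum>i=1..n. ennreal \<bar>x i * \<xi> i \<omega>\<bar> * indicator {N..} \<bar>x i * \<xi> i \<omega>\<bar>) \<partial>M)"
  proof (rule nn_integral_mono)
    fix \<omega>
    have "ennreal (MAX i\<in>{1..n}. \<bar>x i * \<xi> i \<omega>\<bar>) \<le>
      ennreal (N + (\<Sum>i=1..n. \<bar>x i * \<xi> i \<omega>\<bar> * indicator {N..} \<bar>x i * \<xi> i \<omega>\<bar>))"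
      using \<open>n \<ge> 1\<close> \<open>N > 0\<close> by (intro ennreal_leI Max_le_level_plus_excess) auto
    also have "\<dots> = ennreal N +
      (\<Sum>i=1..n. ennreal \<bar>x i * \<xi> i \<omega>\<bar> * indicator {N..} \<bar>x i * \<xi> i \<omega>\<bar>)"
      using \<open>N > 0\<close>
      by (simp add: ennreal_plus sum_nonneg ennreal_mult ennreal_indicator flip: sum_ennreal)
    finally show "ennreal (MAX i\<in>{1..n}. \<bar>x i * \<xi> i \<omega>\<bar>) \<le> \<dots>" .
  qed
  also have "\<dots> = ennreal N +
    (\<Sum>i=1..n. \<integral>\<^sup>+\<omega>. ennreal \<bar>x i * \<xi> i \<omega>\<bar> * indicator {N..} \<bar>x i * \<xi> i \<omega>\<bar> \<partial>M)"
  proof (subst nn_integral_add)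
    show "(\<lambda>\<omega>. \<Sum>i=1..n. ennreal \<bar>x i * \<xi> i \<omega>\<bar> * indicator {N..} \<bar>x i * \<xi> i \<omega>\<bar>)
      \<in> borel_measurable M"
      by measurable
    show "(\<integral>\<^sup>+\<omega>. ennreal N \<partial>M) +
        (\<integral>\<^sup>+\<omega>. (\<Sum>i=1..n. ennreal \<bar>x i * \<xi> i \<omega>\<bar> * indicator {N..} \<bar>x i * \<xi> i \<omega>\<bar>) \<partial>M) =
      ennreal N +
        (\<Sum>i=1..n. \<integral>\<^sup>+\<omega>. ennreal \<bar>x i * \<xi> i \<omega>\<bar> * indicator {N..} \<bar>x i * \<xi> i \<omega>\<bar> \<partial>M)"
      by (subst nn_integral_sum) (auto simp: emeasure_space_1)
  qed simp
  also have "\<dots> = ennreal N + (\<Sum>i=1..n. ennreal (2 * (x i)\<^sup>2 / N))"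
    using log_gamma_truncated_mean[OF X le \<open>N > 0\<close>] by simp
  also have "\<dots> = ennreal (N + (\<Sum>i=1..n. 2 * (x i)\<^sup>2 / N))"
    using \<open>N > 0\<close> by (simp add: ennreal_plus sum_nonneg)
  also have "(\<Sum>i=1..n. 2 * (x i)\<^sup>2 / N) = 2 * N"
    using \<open>N > 0\<close> sum_sq by (simp add: power2_eq_square flip: sum_divide_distrib sum_distrib_left)
  finally show ?thesis by simp
qed

lemma prob_max_less_le:
  fixes x :: "nat \<Rightarrow> real"
  assumes iid: "iid_log_gamma M 1 2 n \<xi>" and "n \<ge> 1"
    and N_def: "N = sqrt (\<Sum>i=1..n. (x i)\<^sup>2)" and "N > 0"
  shows "measure M {\<omega> \<in> space M. (MAX i\<in>{1..n}. \<bar>x i * \<xi> i \<omega>\<bar>) < N} \<le> exp (- 1)"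
proof -
  interpret prob_space M using iid by (simp add: iid_log_gamma_def)
  have X: "log_gamma_distributed M 1 2 (\<xi> i)" if "i \<in> {1..n}" for i
    using iid that by (simp add: iid_log_gamma_def)
  have meas[measurable]: "\<xi> i \<in> borel_measurable M" if "i \<in> {1..n}" for i
    using X[OF that] by (simp add: log_gamma_distributed_def distributed_def)
  have le: "\<bar>x i\<bar> \<le> N" if "i \<in> {1..n}" for i
    unfolding N_def using that by (intro abs_le_euclidean_norm) auto
  have sum_sq: "(\<Sum>i=1..n. (x i)\<^sup>2) = N\<^sup>2"
    by (simp add: N_def sum_nonneg)
  define A where "A i = {t. \<bar>x i * t\<bar> < N}" for i
  have A: "A i \<in> sets borel" for i
    unfolding A_def by measurable
  have "{\<omega> \<in> space M. (MAX i\<in>{1..n}. \<bar>x i * \<xi> i \<omega>\<bar>) < N} =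
      (\<Inter>i\<in>{1..n}. \<xi> i -` A i \<inter> space M)"
    using \<open>n \<ge> 1\<close> by (auto simp: A_def)
  also have "prob \<dots> = (\<Prod>i\<in>{1..n}. prob (\<xi> i -` A i \<inter> space M))"
    using iid \<open>n \<ge> 1\<close> A by (intro indep_varsD[where I = "{1..n}"]) (auto simp: iid_log_gamma_def)
  also have "\<dots> \<le> (\<Prod>i\<in>{1..n}. exp (- ((x i / N)\<^sup>2)))"
  proof (rule prod_mono, intro conjI)
    fix i assume i: "i \<in> {1..n}"
    note [measurable] = meas[OF i]
    have "\<xi> i -` A i \<inter> space M = space M - {\<omega> \<in> space M. N \<le> \<bar>x i * \<xi> i \<omega>\<bar>}"
      by (auto simp: A_def)
    also have "prob \<dots> = 1 - (x i / N)\<^sup>2"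
      using log_gamma_tail[OF X[OF i] le[OF i] \<open>N > 0\<close>] by (subst prob_compl) auto
    also have "\<dots> \<le> exp (- ((x i / N)\<^sup>2))"
      using exp_ge_add_one_self[of "- ((x i / N)\<^sup>2)"] by simp
    finally show "prob (\<xi> i -` A i \<inter> space M) \<le> exp (- ((x i / N)\<^sup>2))" .
  qed simp
  also have "\<dots> = exp (- (\<Sum>i=1..n. (x i / N)\<^sup>2))"
    by (simp add: exp_sum flip: sum_negf)
  also have "(\<Sum>i=1..n. (x i / N)\<^sup>2) = 1"
    using \<open>N > 0\<close> sum_sq by (simp add: power_divide flip: sum_divide_distrib)
  finally show ?thesis .
qed

theorem expected_max_bounds_explicit: "expected_max_bounds TYPE('a) (1 - exp (- 1)) 3"
  unfolding expected_max_bounds_def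
proof (intro allI impI)
  fix n :: nat and M :: "'a measure" and \<xi> and x :: "nat \<Rightarrow> real"
  assume n: "n \<ge> 1" and iid: "iid_log_gamma M 1 2 n \<xi>"
  define N where "N = sqrt (\<Sum>i=1..n. (x i)\<^sup>2)"
  define Y where "Y \<omega> = (MAX i\<in>{1..n}. \<bar>x i * \<xi> i \<omega>\<bar>)" for \<omega>
  interpret prob_space M using iid by (simp add: iid_log_gamma_def)
  have [measurable]: "\<xi> i \<in> borel_measurable M" if "i \<in> {1..n}" for i
    using iid that by (simp add: iid_log_gamma_def log_gamma_distributed_def distributed_def)
  have Y_meas[measurable]: "Y \<in> borel_measurable M"
    unfolding Y_def by measurable
  have Y_nonneg: "Y \<omega> \<ge> 0" for \<omega>
  proof -
    have "\<bar>x 1 * \<xi> 1 \<omega>\<bar> \<le> Y \<omega>"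
      unfolding Y_def using n by (intro Max_ge) auto
    then show ?thesis using abs_ge_zero order_trans by blast
  qed
  have N_nonneg: "N \<ge> 0" by (simp add: N_def sum_nonneg)
  have "integrable M Y \<and> (1 - exp (- 1)) * N \<le> expectation Y \<and> expectation Y \<le> 3 * N"
  proof (cases "N = 0")
    case True
    then have "x i = 0" if "i \<in> {1..n}" for i
      using abs_le_euclidean_norm[of "{1..n}" i x] that by (simp add: N_def)
    then have "Y = (\<lambda>\<omega>. MAX i\<in>{1..n}. 0)"
      by (auto simp: Y_def fun_eq_iff intro!: arg_cong[where f = Max] image_cong)
    also have "\<dots> = (\<lambda>\<omega>. 0)" using n by simp
    finally show ?thesis using True by simp
  next
    case False
    then have N: "N > 0" using N_nonneg by simp
    have nn_le: "(\<integral>\<^sup>+\<omega>. ennreal (Y \<omega>) \<partial>M) \<le> ennreal (3 * N)"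
      unfolding Y_def by (rule nn_integral_max_le[OF iid n N_def N])
    have int: "integrable M Y"
      using Y_nonneg order.strict_trans1[OF nn_le]
      by (intro integrableI_nonneg) auto
    have "(1 - exp (- 1)) * N \<le> prob {\<omega> \<in> space M. N \<le> Y \<omega>} * N"
    proof -
      have "prob (space M - {\<omega> \<in> space M. Y \<omega> < N}) = 1 - prob {\<omega> \<in> space M. Y \<omega> < N}"
        by (rule prob_compl) simp
      also have "space M - {\<omega> \<in> space M. Y \<omega> < N} = {\<omega> \<in> space M. N \<le> Y \<omega>}"
        by auto
      finally show ?thesis
        using prob_max_less_le[OF iid n N_def N] N by (simp add: Y_def)
    qed
    also have "\<dots> \<le> expectation Y"
      using integral_Markov_inequality_measure[OF int, of "{}" N] Y_nonneg N
      by (simp add: field_simps)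
    finally show ?thesis
      using int integral_real_bounded[OF _ nn_le] N by simp
  qed
  then show "integrable M (\<lambda>\<omega>. MAX i\<in>{1..n}. \<bar>x i * \<xi> i \<omega>\<bar>) \<and>
      (1 - exp (- 1)) * sqrt (\<Sum>i=1..n. (x i)\<^sup>2)
        \<le> (LINT \<omega>|M. (MAX i\<in>{1..n}. \<bar>x i * \<xi> i \<omega>\<bar>)) \<and>
      (LINT \<omega>|M. (MAX i\<in>{1..n}. \<bar>x i * \<xi> i \<omega>\<bar>)) \<le> 3 * sqrt (\<Sum>i=1..n. (x i)\<^sup>2)"
    by (simp add: Y_def[abs_def] N_def)
qed

section \<open>Independence of the sample space\<close>

lemma distr_lborel_eq_distr_borel: "distr M lborel f = distr M borel f"
  by (rule distr_cong) auto

definition joint_law :: "'a measure \<Rightarrow> nat \<Rightarrow> (nat \<Rightarrow> 'a \<Rightarrow> real) \<Rightarrow> (nat \<Rightarrow> real) measure" where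
  "joint_law M n \<xi> = distr M (\<Pi>\<^sub>M i\<in>{1..n}. borel) (\<lambda>\<omega>. \<lambda>i\<in>{1..n}. \<xi> i \<omega>)"

text \<open>
  Independence says that the joint law is the product of its marginals. The joint law of the
  coordinates on the product space is the joint law itself, so the criterion carries over
  verbatim.
\<close>

lemma iid_log_gamma_joint_law:
  assumes iid: "iid_log_gamma M q p n \<xi>" and "n \<ge> 1"
  shows "iid_log_gamma (joint_law M n \<xi>) q p n (\<lambda>i \<omega>. \<omega> i)"
proof -
  interpret prob_space M using iid by (simp add: iid_log_gamma_def)
  have [measurable]: "\<xi> i \<in> borel_measurable M" if "i \<in> {1..n}" for i
    using iid that by (simp add: iid_log_gamma_def log_gamma_distributed_def distributed_def)
  let ?P = "\<Pi>\<^sub>M i\<in>{1..n}. borel :: real measure"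
  let ?X = "\<lambda>\<omega>. \<lambda>i\<in>{1..n}. \<xi> i \<omega>"
  have X[measurable]: "?X \<in> measurable M ?P"
    by (intro measurable_restrict) auto
  interpret L: prob_space "joint_law M n \<xi>"
    unfolding joint_law_def by (rule prob_space_distr) (rule X)
  have coord: "(\<lambda>\<omega>. \<omega> i) \<in> borel_measurable (joint_law M n \<xi>)" if "i \<in> {1..n}" for i
    unfolding joint_law_def using that by simp
  have marginal: "distr (joint_law M n \<xi>) borel (\<lambda>\<omega>. \<omega> i) = distr M borel (\<xi> i)"
    if "i \<in> {1..n}" for i
    unfolding joint_law_def using that
    by (subst distr_distr) (auto simp: comp_def)
  have "distr (joint_law M n \<xi>) ?P (\<lambda>\<omega>. \<lambda>i\<in>{1..n}. \<omega> i) = distr (joint_law M n \<xi>) ?P (\<lambda>\<omega>. \<omega>)"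
    by (rule distr_cong) (auto simp: joint_law_def space_PiM intro!: PiE_restrict)
  also have "\<dots> = joint_law M n \<xi>"
    unfolding joint_law_def by (rule distr_id2) simp
  also have "\<dots> = (\<Pi>\<^sub>M i\<in>{1..n}. distr M borel (\<xi> i))"
    using iid \<open>n \<ge> 1\<close> unfolding joint_law_def
    by (subst indep_vars_iff_distr_eq_PiM'[symmetric]) (auto simp: iid_log_gamma_def)
  also have "\<dots> = (\<Pi>\<^sub>M i\<in>{1..n}. distr (joint_law M n \<xi>) borel (\<lambda>\<omega>. \<omega> i))"
    by (rule PiM_cong) (auto simp: marginal)
  finally have "L.indep_vars (\<lambda>_. borel) (\<lambda>i \<omega>. \<omega> i) {1..n}"
    using \<open>n \<ge> 1\<close> coord by (subst L.indep_vars_iff_distr_eq_PiM') auto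
  moreover have "log_gamma_distributed (joint_law M n \<xi>) q p (\<lambda>\<omega>. \<omega> i)" if "i \<in> {1..n}" for i
  proof -
    have "log_gamma_distributed M q p (\<xi> i)"
      using iid that by (simp add: iid_log_gamma_def)
    then show ?thesis
      using coord[OF that] marginal[OF that]
      by (simp add: log_gamma_distributed_def distributed_def distr_lborel_eq_distr_borel)
  qed
  ultimately show ?thesis
    by (simp add: iid_log_gamma_def L.prob_space_axioms)
qed

lemma expected_max_bounds_transfer:
  assumes bounds: "expected_max_bounds TYPE(nat \<Rightarrow> real) c C"
  shows "expected_max_bounds TYPE('a) c C"
  unfolding expected_max_bounds_def
proof (intro allI impI)
  fix n :: nat and M :: "'a measure" and \<xi> and x :: "nat \<Rightarrow> real"
  assume n: "n \<ge> 1" and iid: "iid_log_gamma M 1 2 n \<xi>"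
  have [measurable]: "\<xi> i \<in> borel_measurable M" if "i \<in> {1..n}" for i
    using iid that by (simp add: iid_log_gamma_def log_gamma_distributed_def distributed_def)
  let ?P = "\<Pi>\<^sub>M i\<in>{1..n}. borel :: real measure"
  let ?X = "\<lambda>\<omega>. \<lambda>i\<in>{1..n}. \<xi> i \<omega>"
  let ?Y = "\<lambda>\<omega>. MAX i\<in>{1..n}. \<bar>x i * \<xi> i \<omega>\<bar>"
  let ?Z = "\<lambda>\<omega>. MAX i\<in>{1..n}. \<bar>x i * \<omega> i\<bar>"
  have X: "?X \<in> measurable M ?P"
    by (intro measurable_restrict) auto
  have Z: "?Z \<in> borel_measurable ?P"
    by measurable
  have YZ: "?Z (?X \<omega>) = ?Y \<omega>" for \<omega>
    by (intro arg_cong[where f = Max] image_cong) auto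
  have "integrable (joint_law M n \<xi>) ?Z \<longleftrightarrow> integrable M ?Y"
    unfolding joint_law_def integrable_distr_eq[OF X Z] YZ ..
  moreover have "(LINT \<omega>|joint_law M n \<xi>. ?Z \<omega>) = (LINT \<omega>|M. ?Y \<omega>)"
    unfolding joint_law_def integral_distr[OF X Z] YZ ..
  ultimately show "integrable M ?Y \<and>
      c * sqrt (\<Sum>i=1..n. (x i)\<^sup>2) \<le> (LINT \<omega>|M. ?Y \<omega>) \<and>
      (LINT \<omega>|M. ?Y \<omega>) \<le> C * sqrt (\<Sum>i=1..n. (x i)\<^sup>2)"
    using bounds[unfolded expected_max_bounds_def, rule_format, OF n iid_log_gamma_joint_law[OF iid n], of x]
    by simp
qed

theorem corollary3p1:
  "(\<exists>c>0. \<exists>C>0. expected_max_bounds TYPE(nat \<Rightarrow> real) c C) \<and>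
   (\<forall>c>0. \<forall>C>0. expected_max_bounds TYPE(nat \<Rightarrow> real) c C \<longrightarrow> expected_max_bounds TYPE('a) c C)"
proof
  have "1 - exp (- 1) > (0::real)" by simp
  then show "\<exists>c>0. \<exists>C>0. expected_max_bounds TYPE(nat \<Rightarrow> real) c C"
    using expected_max_bounds_explicit by (metis zero_less_numeral)
  show "\<forall>c>0. \<forall>C>0. expected_max_bounds TYPE(nat \<Rightarrow> real) c C \<longrightarrow> expected_max_bounds TYPE('a) c C"
    using expected_max_bounds_transfer by blast
qed

end
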